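(* Let $L:U\to V$ be a bounded linear operator between two real Hilbert spaces $U$ and $V$, let $y\in\mathcal R(L)$, and let $u^\dagger$ denote the minimum-norm solution of $Lu=y$. Then for arbitrary $\nu\in(0,2)$ and $\rho>\nu$ the following two conditions are equivalent: (i) $u^\dagger$ has a spectral tail of order $\nu$: there exists a constant $C>0$ such that $\|E_{[0,\lambda]}u^\dagger\|^2\le C^2\lambda^\nu$ for all $\lambda\ge0$; (ii) there exists a constant $\beta\ge0$ such that \[ 2\langle u^\dagger,u\rangle\le\beta\,\|(L^*L)^{\frac\rho2}u\|^{\frac\nu\rho}\,\|u\|^{1-\frac\nu\rho}\quad\text{for all } u\in U. \]
   Context: $\mathcal R(L)$ denotes the range of $L$. For $y\in\mathcal R(L)$, the minimum-norm solution $u^\dagger\in U$ is the unique element with $Lu^\dagger=y$ and $\|u^\dagger\|=\inf\{\|u\|:Lu=y\}$. $A\mapsto E_A$ denotes the projection-valued spectral measure of the bounded, self-adjoint, non-negative operator $L^*L$, and powers $(L^*L)^r$, $r>0$, are defined by its functional calculus. *)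

theory Defs
  imports "HOL-Analysis.Analysis"
begin

text \<open>Real Hilbert spaces are types of sort \<open>{real_inner, complete_space}\<close>. For bounded
  operators between them the library constant \<^const>\<open>adjoint\<close> is the Hilbert space adjoint.\<close>

definition min_norm_solution :: "('a::real_normed_vector \<Rightarrow> 'b) \<Rightarrow> 'b \<Rightarrow> 'a" where
  "min_norm_solution L y = (THE u. L u = y \<and> norm u = Inf {norm w | w. L w = y})"

definition orthogonal_projection :: "('a::real_inner \<Rightarrow> 'a) \<Rightarrow> bool" where
  "orthogonal_projection P \<longleftrightarrow>
     bounded_linear P \<and> P \<circ> P = P \<and> (\<forall>u v. P u \<bullet> v = u \<bullet> P v)"

text \<open>Only the values on Borel sets matter; countable additivity is in the strong operator
  topology.\<close>

definition projection_valued_measure :: "(real set \<Rightarrow> 'a::real_inner \<Rightarrow> 'a) \<Rightarrow> bool" where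
  "projection_valued_measure E \<longleftrightarrow>
     (\<forall>A \<in> sets borel. orthogonal_projection (E A)) \<and>
     E UNIV = id \<and>
     (\<forall>A \<in> sets borel. \<forall>B \<in> sets borel. E (A \<inter> B) = E A \<circ> E B) \<and>
     (\<forall>A :: nat \<Rightarrow> real set. range A \<subseteq> sets borel \<longrightarrow> disjoint_family A \<longrightarrow>
        (\<forall>u. (\<lambda>n. E (A n) u) sums E (\<Union>n. A n) u))"

definition spectral_scalar_measure ::
    "(real set \<Rightarrow> 'a::real_inner \<Rightarrow> 'a) \<Rightarrow> 'a \<Rightarrow> real measure" where
  "spectral_scalar_measure E u = measure_of UNIV (sets borel) (\<lambda>A. ennreal (E A u \<bullet> u))"

text \<open>The integral of \<open>f\<close> against the signed measure \<open>A \<mapsto> \<langle>E A u, v\<rangle>\<close>, which by polarization is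
  a quarter of the difference of the scalar measures of \<open>u + v\<close> and \<open>u - v\<close>.\<close>

definition spectral_form ::
    "(real set \<Rightarrow> 'a::real_inner \<Rightarrow> 'a) \<Rightarrow> (real \<Rightarrow> real) \<Rightarrow> 'a \<Rightarrow> 'a \<Rightarrow> real" where
  "spectral_form E f u v =
     (integral\<^sup>L (spectral_scalar_measure E (u + v)) f
      - integral\<^sup>L (spectral_scalar_measure E (u - v)) f) / 4"

text \<open>The spectral measure of a bounded self-adjoint operator \<open>T\<close>: the projection-valued measure
  with \<open>T = \<integral>\<lambda> dE\<close>. The boundedness of the support, which holds since the spectrum of \<open>T\<close> is
  compact, makes the integrals below converge; without it, the value 0 of the library integral
  for non-integrable functions would intervene.\<close>

definition is_spectral_measure ::
    "('a::real_inner \<Rightarrow> 'a) \<Rightarrow> (real set \<Rightarrow> 'a \<Rightarrow> 'a) \<Rightarrow> bool" where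
  "is_spectral_measure T E \<longleftrightarrow>
     projection_valued_measure E \<and>
     (\<exists>R. E {-R..R} = id) \<and>
     (\<forall>u v. T u \<bullet> v = spectral_form E (\<lambda>t. t) u v)"

text \<open>\<open>f(T) = \<integral>f dE\<close> in the weak sense, for Borel \<open>f\<close> bounded on the support of \<open>E\<close>.\<close>

definition functional_calculus ::
    "(real set \<Rightarrow> 'a::real_inner \<Rightarrow> 'a) \<Rightarrow> (real \<Rightarrow> real) \<Rightarrow> 'a \<Rightarrow> 'a" where
  "functional_calculus E f u = (THE w. \<forall>v. w \<bullet> v = spectral_form E f u v)"

text \<open>The power \<open>T\<^sup>r\<close>, \<open>r > 0\<close>, of the non-negative operator \<open>T\<close> with spectral measure \<open>E\<close>. Since
  \<open>E\<close> then vanishes on the negative half-line, the values of \<^term>\<open>t powr r\<close> for \<open>t < 0\<close> are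
  irrelevant; and \<^term>\<open>0 powr r = 0\<close>.\<close>

definition operator_power ::
    "(real set \<Rightarrow> 'a::real_inner \<Rightarrow> 'a) \<Rightarrow> real \<Rightarrow> 'a \<Rightarrow> 'a" where
  "operator_power E r = functional_calculus E (\<lambda>t. t powr r)"

definition spectral_tail ::
    "(real set \<Rightarrow> 'a::real_inner \<Rightarrow> 'a) \<Rightarrow> real \<Rightarrow> 'a \<Rightarrow> bool" where
  "spectral_tail E \<nu> u \<longleftrightarrow>
     (\<exists>C>0. \<forall>t\<ge>0. (norm (E {0..t} u))\<^sup>2 \<le> C\<^sup>2 * t powr \<nu>)"

end

theory Submission
  imports Defs "HOL-Real_Asymp.Real_Asymp"
begin

text \<open>Let \<open>x = u\<^sup>\<dagger>\<close>, \<open>T = L\<^sup>*L\<close> and \<open>r = \<rho>/2\<close>.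

  For (ii) \<open>\<Longrightarrow>\<close> (i), test the inequality with \<open>u = E\<^bsub>[0,t]\<^esub> x\<close>, for which \<open>\<langle>x, u\<rangle> = \<parallel>u\<parallel>\<^sup>2\<close> and
  \<open>\<parallel>T\<^sup>r u\<parallel> \<le> t\<^sup>r \<parallel>u\<parallel>\<close>.

  For (i) \<open>\<Longrightarrow>\<close> (ii), split \<open>\<langle>x, u\<rangle>\<close> at \<open>t > 0\<close>. The part over \<open>[0,t]\<close> is at most
  \<open>C t\<^bsup>\<nu>/2\<^esup> \<parallel>u\<parallel>\<close>. The part over \<open>(t,\<infinity>)\<close> is cut into dyadic pieces: since
  \<open>s\<^sup>r \<parallel>E\<^bsub>(s,\<infinity>)\<^esub> u\<parallel> \<le> \<parallel>T\<^sup>r u\<parallel>\<close>, Cauchy-Schwarz on each piece gives a geometric series of ratio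
  \<open>2\<^bsup>(\<nu>-\<rho>)/2\<^esup>\<close>. The choice \<open>t\<^sup>r = \<parallel>T\<^sup>r u\<parallel> / \<parallel>u\<parallel>\<close> balances the two parts.\<close>

section \<open>Riesz representation and the Hilbert space adjoint\<close>

lemma riesz_representation:
  fixes f :: "'a::{real_inner, complete_space} \<Rightarrow> real"
  assumes "bounded_linear f"
  shows "\<exists>w. \<forall>x. f x = w \<bullet> x"
proof -
  interpret f: bounded_linear f by fact
  define J where "J x = x \<bullet> x - 2 * f x" for x
  \<comment> \<open>The representing vector is the minimizer of \<open>J\<close>; by the parallelogram law,
    minimizing sequences are Cauchy.\<close>
  obtain K where K: "\<And>x. norm (f x) \<le> norm x * K"
    using f.nonneg_bounded by blast
  \<comment> \<open>Completing the square: \<open>J x\<close> is at least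
    \<open>(norm x)^2 - 2 * K * norm x\<close>, whose minimum is \<open>- K^2\<close>.\<close>
  have "J x \<ge> - K\<^sup>2" for x
  proof -
    have "0 \<le> (norm x - K)\<^sup>2" by simp
    moreover have "f x \<le> norm x * K" using K[of x] by simp
    ultimately show ?thesis
      by (simp add: J_def power2_norm_eq_inner[symmetric] power2_diff)
  qed
  then have bdd: "bdd_below (range J)" by (intro bdd_belowI[of _ "- K\<^sup>2"]) blast
  define m where "m = Inf (range J)"
  have m: "m \<le> J x" for x
    unfolding m_def using bdd by (auto intro: cInf_lower)
  have "\<exists>x. J x < m + 1 / real (Suc n)" for n
    using cInf_lessD[of "range J" "m + 1 / real (Suc n)"] by (auto simp: m_def)
  then obtain X where X: "\<And>n. J (X n) < m + 1 / real (Suc n)" by metis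
  have par: "(norm (x - y))\<^sup>2 = 2 * (J x + J y - 2 * J ((1/2) *\<^sub>R (x + y)))" for x y
    by (simp add: J_def power2_norm_eq_inner f.scaleR f.add algebra_simps inner_commute)
  have dist: "(dist (X i) (X j))\<^sup>2 \<le> 4 / real (Suc n)" if "n \<le> i" "n \<le> j" for n i j
  proof -
    have "1 / real (Suc i) \<le> 1 / real (Suc n)" "1 / real (Suc j) \<le> 1 / real (Suc n)"
      using that by (auto simp: frac_le)
    then show ?thesis
      using par[of "X i" "X j"] m[of "(1/2) *\<^sub>R (X i + X j)"] X[of i] X[of j]
      by (simp add: dist_norm)
  qed
  have "Cauchy X"
  proof (rule metric_CauchyI)
    fix e :: real assume "e > 0"
    obtain n where n: "4 / e\<^sup>2 < real n" using reals_Archimedean2 by blast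
    then have "4 / real (Suc n) < e\<^sup>2"
      using \<open>e > 0\<close> by (simp add: field_simps) (smt (verit) zero_less_power)
    then have "dist (X i) (X j) < e" if "n \<le> i" "n \<le> j" for i j
      using dist[OF that] \<open>e > 0\<close> by (meson le_less_trans power_less_imp_less_base less_imp_le)
    then show "\<exists>n. \<forall>i\<ge>n. \<forall>j\<ge>n. dist (X i) (X j) < e" by blast
  qed
  then obtain w where w: "X \<longlonglongrightarrow> w" using Cauchy_convergent convergent_def by blast
  have "(\<lambda>n. J (X n)) \<longlonglongrightarrow> J w"
    unfolding J_def by (intro tendsto_intros w f.tendsto)
  moreover have "(\<lambda>n. m + 1 / real (Suc n)) \<longlonglongrightarrow> m + 0"
    by (intro tendsto_intros LIMSEQ_Suc[OF lim_1_over_n])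
  ultimately have Jw: "J w \<le> m"
    using X by (force intro: LIMSEQ_le less_imp_le)
  have "f x = w \<bullet> x" for x
  proof (rule ccontr)
    assume ne: "f x \<noteq> w \<bullet> x"
    then have "x \<noteq> 0" by auto
    then have pos: "x \<bullet> x > 0" by simp
    define d where "d = w \<bullet> x - f x"
    \<comment> \<open>This \<open>s\<close> minimizes the quadratic \<open>J (w + s x)\<close> in
      the direction \<open>x\<close>. If \<open>w\<close> failed to represent \<open>f\<close> at
      \<open>x\<close>, moving by it would push \<open>J\<close> strictly below its infimum.\<close>
    define s where "s = - d / (x \<bullet> x)"
    have "J (w + s *\<^sub>R x) = J w + 2 * s * d + s\<^sup>2 * (x \<bullet> x)"
      by (simp add: J_def d_def f.scaleR f.add algebra_simps inner_commute power2_eq_square)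
    moreover have "2 * s * d + s\<^sup>2 * (x \<bullet> x) = - d\<^sup>2 / (x \<bullet> x)"
      using pos by (simp add: s_def field_simps power2_eq_square)
    ultimately have "J (w + s *\<^sub>R x) = J w - d\<^sup>2 / (x \<bullet> x)" by simp
    moreover have "d\<^sup>2 / (x \<bullet> x) > 0" using ne pos by (simp add: d_def)
    ultimately show False using m[of "w + s *\<^sub>R x"] Jw by linarith
  qed
  then show ?thesis by blast
qed

text \<open>The constant \<open>adjoint\<close> is chosen by Hilbert choice among maps with this
  property, so all that has to be supplied is the existence of one. For each \<open>y\<close>, Riesz
  represents the functional sending \<open>x\<close> to \<open>L x \<bullet> y\<close>.\<close>

lemma adjoint_inner:
  fixes L :: "'a::{real_inner, complete_space} \<Rightarrow> 'b::real_inner"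
  assumes "bounded_linear L"
  shows "L x \<bullet> y = x \<bullet> adjoint L y"
proof -
  have "\<exists>w. \<forall>x. L x \<bullet> y = w \<bullet> x" for y
    by (intro riesz_representation bounded_linear_compose[OF bounded_linear_inner_left assms])
  then have "\<exists>L'. \<forall>x y. L x \<bullet> y = x \<bullet> L' y"
    by (metis inner_commute)
  then show ?thesis
    unfolding adjoint_def by (rule someI2_ex) blast
qed

section \<open>Projection-valued measures and their scalar measures\<close>

lemma space_spectral_scalar_measure [simp]: "space (spectral_scalar_measure E u) = UNIV"
  and sets_spectral_scalar_measure [simp, measurable_cong]:
    "sets (spectral_scalar_measure E u) = sets borel"
  using sets.sigma_sets_eq[of "borel :: real measure"]
  by (simp_all add: spectral_scalar_measure_def space_measure_of_conv sets_measure_of_conv)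

context
  fixes E :: "real set \<Rightarrow> 'a::real_inner \<Rightarrow> 'a"
  assumes pvm: "projection_valued_measure E"
begin

lemma pvm_projection: "A \<in> sets borel \<Longrightarrow> orthogonal_projection (E A)"
  using pvm by (simp add: projection_valued_measure_def)

lemma pvm_linear: "A \<in> sets borel \<Longrightarrow> bounded_linear (E A)"
  using pvm_projection by (simp add: orthogonal_projection_def)

lemma pvm_inner_commute: "A \<in> sets borel \<Longrightarrow> E A u \<bullet> v = u \<bullet> E A v"
  using pvm_projection by (simp add: orthogonal_projection_def)

lemma pvm_Int: "A \<in> sets borel \<Longrightarrow> B \<in> sets borel \<Longrightarrow> E A (E B u) = E (A \<inter> B) u"
  using pvm by (simp add: projection_valued_measure_def)

lemma pvm_sums:
  "range A \<subseteq> sets borel \<Longrightarrow> disjoint_family A \<Longrightarrow> (\<lambda>n. E (A n) u) sums E (\<Union>n. A n) u"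
  using pvm by (simp add: projection_valued_measure_def)

text \<open>The constant sequence of empty sets is disjoint, and a convergent series with constant
  terms has zero terms.\<close>

lemma pvm_empty: "E {} u = 0"
proof -
  have "(\<lambda>n::nat. E {} u) sums E {} u"
    using pvm_sums[of "\<lambda>_. {}" u] by (simp add: disjoint_family_on_def)
  then show ?thesis
    using summable_LIMSEQ_zero sums_summable LIMSEQ_const_iff by blast
qed

lemma pvm_Un:
  assumes "A \<in> sets borel" "B \<in> sets borel" "A \<inter> B = {}"
  shows "E (A \<union> B) u = E A u + E B u"
proof -
  have "(\<lambda>n. E (binaryset A B n) u) sums E (\<Union>n. binaryset A B n) u"
    using assms by (intro pvm_sums) (auto simp: range_binaryset_eq disjoint_family_on_def binaryset_def)
  moreover have "(\<lambda>n. E (binaryset A B n) u) sums (E A u + E B u)"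
    by (rule binaryset_sums) (simp add: pvm_empty)
  ultimately show ?thesis
    by (simp add: sums_unique2 UN_binaryset_eq)
qed

lemma pvm_inner_self: "A \<in> sets borel \<Longrightarrow> E A u \<bullet> u = (norm (E A u))\<^sup>2"
  using pvm_Int[of A A u] pvm_inner_commute[of A "E A u" u] by (simp add: power2_norm_eq_inner inner_commute)

lemma pvm_norm_mono:
  assumes "A \<in> sets borel" "B \<in> sets borel" "A \<subseteq> B"
  shows "norm (E A u) \<le> norm (E B u)"
proof -
  have "E B u = E A u + E (B - A) u"
    using pvm_Un[of A "B - A" u] assms by (simp add: Un_absorb1)
  then have "E B u \<bullet> u = E A u \<bullet> u + E (B - A) u \<bullet> u" by (simp add: inner_add_left)
  then have "(norm (E B u))\<^sup>2 \<ge> (norm (E A u))\<^sup>2"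
    using assms by (simp add: pvm_inner_self)
  then show ?thesis by (rule power2_le_imp_le) simp
qed

lemma pvm_UNIV: "E UNIV u = u"
  using pvm by (simp add: projection_valued_measure_def)

lemma pvm_restrict:
  assumes "A \<in> sets borel" "E A = id" "B \<in> sets borel"
  shows "E B u = E (A \<inter> B) u"
  using pvm_Int[OF assms(1,3), of u] assms(2) by simp

text \<open>\<open>measure_of\<close> falls back to the zero measure when the given set function is
  not a measure, so countable additivity must be established first. It follows by pairing the
  strongly convergent series of projections with \<open>u\<close>.\<close>

lemma emeasure_spectral_scalar_measure:
  assumes "A \<in> sets borel"
  shows "emeasure (spectral_scalar_measure E u) A = ennreal (E A u \<bullet> u)"
proof (rule emeasure_measure_of[OF spectral_scalar_measure_def])
  show "sets borel \<subseteq> Pow (UNIV :: real set)" by simp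
  show "A \<in> sets (spectral_scalar_measure E u)" using assms by simp
  show "positive (sets (spectral_scalar_measure E u)) (\<lambda>A. ennreal (E A u \<bullet> u))"
    by (simp add: positive_def pvm_empty)
  show "countably_additive (sets (spectral_scalar_measure E u)) (\<lambda>A. ennreal (E A u \<bullet> u))"
  proof (rule countably_additiveI)
    fix A :: "nat \<Rightarrow> real set"
    assume A: "range A \<subseteq> sets (spectral_scalar_measure E u)" "disjoint_family A"
    then have "(\<lambda>n. E (A n) u \<bullet> u) sums (E (\<Union>n. A n) u \<bullet> u)"
      by (intro bounded_linear.sums[OF bounded_linear_inner_left] pvm_sums) simp_all
    moreover have "0 \<le> E (A n) u \<bullet> u" for n
      using A by (subst pvm_inner_self) auto
    ultimately show "(\<Sum>n. ennreal (E (A n) u \<bullet> u)) = ennreal (E (\<Union>n. A n) u \<bullet> u)"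
      by (rule suminf_ennreal_eq[rotated])
  qed
qed

lemma measure_spectral_scalar_measure:
  "A \<in> sets borel \<Longrightarrow> measure (spectral_scalar_measure E u) A = E A u \<bullet> u"
  by (simp add: measure_def emeasure_spectral_scalar_measure pvm_inner_self)

lemma finite_spectral_scalar_measure: "finite_measure (spectral_scalar_measure E u)"
  by (rule finite_measureI) (simp add: emeasure_spectral_scalar_measure)

lemma AE_spectral_scalar_measure:
  assumes "A \<in> sets borel" "E A = id"
  shows "AE t in spectral_scalar_measure E u. t \<in> A"
proof (rule AE_I)
  show "{t \<in> space (spectral_scalar_measure E u). t \<notin> A} \<subseteq> - A" by auto
  have "E (- A) u = 0"
    using pvm_restrict[OF assms, of "- A" u] assms(1) by (simp add: pvm_empty)
  then show "emeasure (spectral_scalar_measure E u) (- A) = 0"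
    using assms(1) by (simp add: emeasure_spectral_scalar_measure)
  show "- A \<in> sets (spectral_scalar_measure E u)" using assms(1) by simp
qed

lemma integrable_spectral_scalar_measure:
  fixes f :: "real \<Rightarrow> real"
  assumes "f \<in> borel_measurable borel" "\<And>t. 0 \<le> f t" "\<And>t. f t \<le> M"
  shows "integrable (spectral_scalar_measure E u) f"
  using assms
  by (intro finite_measure.integrable_const_bound[OF finite_spectral_scalar_measure, of _ M])
    auto

lemma integral_spectral_scalar_measure_bounds:
  fixes f :: "real \<Rightarrow> real"
  assumes "f \<in> borel_measurable borel" "\<And>t. 0 \<le> f t" "\<And>t. f t \<le> M"
  shows "0 \<le> integral\<^sup>L (spectral_scalar_measure E u) f"
    and "integral\<^sup>L (spectral_scalar_measure E u) f \<le> M * (norm u)\<^sup>2"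
proof -
  interpret finite_measure "spectral_scalar_measure E u"
    by (rule finite_spectral_scalar_measure)
  show "0 \<le> integral\<^sup>L (spectral_scalar_measure E u) f" using assms(2) by simp
  have "integral\<^sup>L (spectral_scalar_measure E u) f \<le> integral\<^sup>L (spectral_scalar_measure E u) (\<lambda>_. M)"
    using assms by (intro integral_mono integrable_spectral_scalar_measure[of f M]) auto
  also have "\<dots> = M * (norm u)\<^sup>2"
    by (simp add: measure_spectral_scalar_measure pvm_UNIV power2_norm_eq_inner)
  finally show "integral\<^sup>L (spectral_scalar_measure E u) f \<le> M * (norm u)\<^sup>2" .
qed

section \<open>The spectral form of bounded non-negative functions\<close>

lemma spectral_form_indicator:
  assumes "A \<in> sets borel"
  shows "spectral_form E (indicator A) u v = E A u \<bullet> v"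
proof -
  interpret bounded_linear "E A" by (rule pvm_linear[OF assms])
  show ?thesis
    using assms pvm_inner_commute[OF assms, of u v]
    by (simp add: spectral_form_def measure_spectral_scalar_measure add diff
        algebra_simps inner_commute)
qed

lemma spectral_form_add:
  assumes "f \<in> borel_measurable borel" "\<And>t. 0 \<le> f t" "\<And>t. f t \<le> M"
    and "g \<in> borel_measurable borel" "\<And>t. 0 \<le> g t" "\<And>t. g t \<le> N"
  shows "spectral_form E (\<lambda>t. f t + g t) u v = spectral_form E f u v + spectral_form E g u v"
proof -
  have "integrable (spectral_scalar_measure E x) f" "integrable (spectral_scalar_measure E x) g" for x
    using assms by (blast intro: integrable_spectral_scalar_measure)+
  then show ?thesis by (simp add: spectral_form_def field_simps)
qed

lemma spectral_form_mult: "spectral_form E (\<lambda>t. c * f t) u v = c * spectral_form E f u v"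
  by (simp add: spectral_form_def field_simps)

lemma spectral_form_dominated_convergence:
  assumes "\<And>i. U i \<in> borel_measurable borel" "f \<in> borel_measurable borel"
    and "\<And>i t. 0 \<le> U i t" "\<And>i t. U i t \<le> M" "\<And>t. (\<lambda>i. U i t) \<longlonglongrightarrow> f t"
  shows "(\<lambda>i. spectral_form E (U i) u v) \<longlonglongrightarrow> spectral_form E f u v"
proof -
  have "(\<lambda>i. integral\<^sup>L (spectral_scalar_measure E x) (U i))
      \<longlonglongrightarrow> integral\<^sup>L (spectral_scalar_measure E x) f" for x
  proof (rule integral_dominated_convergence)
    interpret finite_measure "spectral_scalar_measure E x"
      by (rule finite_spectral_scalar_measure)
    show "integrable (spectral_scalar_measure E x) (\<lambda>_. M)" by simp
  qed (use assms in auto)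
  then show ?thesis
    unfolding spectral_form_def by (intro tendsto_intros) simp_all
qed

text \<open>The polarized definition hides bilinearity and symmetry. For an indicator the form is
  \<open>E B u \<bullet> v\<close>, where all four identities follow from properties of projections;
  multiples, sums and monotone limits carry them to \<open>f\<close>. The bound \<open>M\<close> is
  generalized in the induction because the pieces of \<open>f\<close> may need another
  bound.\<close>

lemma spectral_form_linear_commute_projection:
  assumes "f \<in> borel_measurable borel" "\<And>t. 0 \<le> f t" "\<And>t. f t \<le> M" and A: "A \<in> sets borel"
  shows "spectral_form E f u (v + v') = spectral_form E f u v + spectral_form E f u v' \<and>
    spectral_form E f u (c *\<^sub>R v) = c * spectral_form E f u v \<and>
    spectral_form E f u v = spectral_form E f v u \<and>
    spectral_form E f (E A u) v = spectral_form E (\<lambda>t. indicator A t * f t) u v"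
    (is "?P f")
  using assms(1-3)
proof (induction arbitrary: M rule: borel_measurable_induct_real)
  case (set B)
  then have B: "B \<in> sets borel" by simp
  have "spectral_form E (indicator B) (E A u) v
      = spectral_form E (\<lambda>t. indicator A t * indicator B t) u v"
    using A B
    by (simp only: spectral_form_indicator pvm_Int Int_commute[of A B] sets.Int
        flip: indicator_inter_arith)
  moreover have "E B u \<bullet> v = E B v \<bullet> u"
    using pvm_inner_commute[OF B] by (simp only: inner_commute[of u])
  ultimately show ?case
    using B by (simp add: spectral_form_indicator inner_add_right)
next
  case (mult g c)
  show ?case
  \<comment> \<open>For \<open>c = 0\<close> the bound on \<open>c * g\<close> says nothing about
    \<open>g\<close>, so the induction hypothesis cannot be applied; the form is then simply
    zero.\<close>
  proof (cases "c = 0")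
    case True
    then show ?thesis by (simp add: spectral_form_def)
  next
    case False
    then have "?P g"
      using mult by (intro mult.IH[of "M / c"]) (simp add: field_simps)
    moreover have "(\<lambda>t. indicator A t * (c * g t)) = (\<lambda>t. c * (indicator A t * g t))"
      by (simp add: mult_ac)
    ultimately show ?thesis
      by (simp only: spectral_form_mult distrib_left mult.left_commute)
  qed
next
  case (add g h)
  have le: "g t \<le> M" "h t \<le> M" for t
    using add.prems[of t] add.hyps(2)[of t] add.hyps(4)[of t] by simp_all
  have M: "M \<ge> 0" using le(1)[of 0] add.hyps(2)[of 0] by linarith
  have 1: "spectral_form E (\<lambda>t. h t + g t) x y = spectral_form E h x y + spectral_form E g x y" for x y
    by (rule spectral_form_add[of _ M _ M]) (use add.hyps le in auto)
  have 2: "spectral_form E (\<lambda>t. indicator A t * (h t + g t)) x y =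
      spectral_form E (\<lambda>t. indicator A t * h t) x y + spectral_form E (\<lambda>t. indicator A t * g t) x y" for x y
    unfolding distrib_left
    by (rule spectral_form_add[of _ M _ M])
      (use add.hyps le A M in \<open>auto simp: indicator_def\<close>)
  show ?case
    using add.IH(1)[OF le(1)] add.IH(2)[OF le(2)] unfolding 1 2 by (simp only: distrib_left ac_simps)
next
  case (seq U)
  \<comment> \<open>The approximants increase to \<open>f\<close> and inherit its bound
    \<open>M\<close>, so dominated convergence takes each identity to the limit.\<close>
  have lim: "(\<lambda>i. U i t) \<longlonglongrightarrow> f t" for t using seq.hyps by simp
  have Uf: "U i t \<le> f t" for i t
    using seq.hyps(3) lim by (intro incseq_le) (auto simp: incseq_def le_fun_def)
  then have le: "U i t \<le> M" for i t using seq.prems(1) order_trans by blast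
  have P: "spectral_form E (U i) u (v + v') = spectral_form E (U i) u v + spectral_form E (U i) u v'"
    "spectral_form E (U i) u (c *\<^sub>R v) = c * spectral_form E (U i) u v"
    "spectral_form E (U i) u v = spectral_form E (U i) v u"
    "spectral_form E (U i) (E A u) v = spectral_form E (\<lambda>t. indicator A t * U i t) u v" for i
    using seq.IH[OF le, of i] by blast+
  have 1: "(\<lambda>i. spectral_form E (U i) x y) \<longlonglongrightarrow> spectral_form E f x y" for x y
    by (rule spectral_form_dominated_convergence[where M = M]) (use seq.hyps assms(1) le lim in auto)
  have "M \<ge> 0" using seq.prems assms(2) order_trans by blast
  then have 2: "(\<lambda>i. spectral_form E (\<lambda>t. indicator A t * U i t) x y)
      \<longlonglongrightarrow> spectral_form E (\<lambda>t. indicator A t * f t) x y" for x y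
    by (intro spectral_form_dominated_convergence[where M = M])
      (use seq.hyps assms(1) le lim A in \<open>auto simp: indicator_def\<close>)
  have "spectral_form E f u (v + v') = spectral_form E f u v + spectral_form E f u v'"
    by (rule LIMSEQ_unique[OF 1]) (unfold P(1), intro tendsto_add 1)
  moreover have "spectral_form E f u (c *\<^sub>R v) = c * spectral_form E f u v"
    by (rule LIMSEQ_unique[OF 1]) (unfold P(2), intro tendsto_mult_left 1)
  moreover have "spectral_form E f u v = spectral_form E f v u"
    using 1[of v u] unfolding P(3)[symmetric] by (rule LIMSEQ_unique[OF 1])
  moreover have "spectral_form E f (E A u) v = spectral_form E (\<lambda>t. indicator A t * f t) u v"
    by (rule LIMSEQ_unique[OF 1]) (unfold P(4), rule 2)
  ultimately show ?case by blast
qed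

lemma spectral_form_commute:
  assumes "f \<in> borel_measurable borel" "\<And>t. 0 \<le> f t" "\<And>t. f t \<le> M"
  shows "spectral_form E f u v = spectral_form E f v u"
  using spectral_form_linear_commute_projection[where A = "{}", OF assms] by simp

lemma spectral_form_projection:
  assumes "f \<in> borel_measurable borel" "\<And>t. 0 \<le> f t" "\<And>t. f t \<le> M" "A \<in> sets borel"
  shows "spectral_form E f (E A u) v = spectral_form E (\<lambda>t. indicator A t * f t) u v"
  using spectral_form_linear_commute_projection[OF assms] by blast

lemma linear_spectral_form:
  assumes "f \<in> borel_measurable borel" "\<And>t. 0 \<le> f t" "\<And>t. f t \<le> M"
  shows "linear (spectral_form E f u)"
  using spectral_form_linear_commute_projection[where A = "{}", OF assms] by (intro linearI) simp_all

text \<open>On the diagonal, polarization uses the vectors \<open>u + u\<close> and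
  \<open>0\<close>. The integral for \<open>0\<close> is squeezed between \<open>0\<close> and
  \<open>M * 0\<close>, which leaves a non-negative integral.\<close>

lemma spectral_form_self_nonneg:
  assumes "f \<in> borel_measurable borel" "\<And>t. 0 \<le> f t" "\<And>t. f t \<le> M"
  shows "0 \<le> spectral_form E f u u"
  using integral_spectral_scalar_measure_bounds[OF assms, of "u + u"]
    integral_spectral_scalar_measure_bounds[OF assms, of 0]
  by (simp add: spectral_form_def)

lemma abs_spectral_form_le:
  assumes f: "f \<in> borel_measurable borel" "\<And>t. 0 \<le> f t" "\<And>t. f t \<le> M"
  shows "\<bar>spectral_form E f u v\<bar> \<le> M * norm u * norm v"
proof -
  interpret linear "spectral_form E f u" by (rule linear_spectral_form[OF f])
  have M: "M \<ge> 0" using f(2,3)[of 0] by linarith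
  \<comment> \<open>Polarization suffices when both arguments have the same norm; \<open>v\<close> is rescaled to that case.\<close>
  have *: "\<bar>spectral_form E f u x\<bar> \<le> M * (norm u)\<^sup>2" if "norm x = norm u" for x
  proof -
    have "(norm (u + x))\<^sup>2 \<le> (2 * norm u)\<^sup>2" "(norm (u - x))\<^sup>2 \<le> (2 * norm u)\<^sup>2"
      using norm_triangle_ineq[of u x] norm_triangle_ineq4[of u x] that
      by (intro power_mono; simp)+
    then have "M * (norm (u + x))\<^sup>2 \<le> M * (2 * norm u)\<^sup>2" "M * (norm (u - x))\<^sup>2 \<le> M * (2 * norm u)\<^sup>2"
      using M by (simp_all add: mult_left_mono)
    then show ?thesis
      using integral_spectral_scalar_measure_bounds[OF f, of "u + x"]
        integral_spectral_scalar_measure_bounds[OF f, of "u - x"]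
      by (simp add: spectral_form_def power_mult_distrib)
  qed
  show ?thesis
  proof (cases "u = 0 \<or> v = 0")
    case True
    have "spectral_form E f 0 v = 0"
      using spectral_form_commute[OF f, of 0 v] linear_0[OF linear_spectral_form[OF f]] by simp
    then show ?thesis using True zero by auto
  next
    case False
    define s where "s = norm u / norm v"
    have s: "s > 0" using False by (simp add: s_def)
    have "s * \<bar>spectral_form E f u v\<bar> = \<bar>spectral_form E f u (s *\<^sub>R v)\<bar>"
      using s by (simp add: scale abs_mult)
    also have "\<dots> \<le> M * (norm u)\<^sup>2"
      using False by (intro *) (simp add: s_def)
    also have "\<dots> = s * (M * norm u * norm v)"
      using False by (simp add: s_def power2_eq_square)
    finally show ?thesis using s by simp
  qed
qed

lemma spectral_form_cong:
  assumes "f \<in> borel_measurable borel" "g \<in> borel_measurable borel"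
    and "S \<in> sets borel" "E S = id" "\<And>t. t \<in> S \<Longrightarrow> f t = g t"
  shows "spectral_form E f = spectral_form E g"
proof -
  have "integral\<^sup>L (spectral_scalar_measure E u) f = integral\<^sup>L (spectral_scalar_measure E u) g" for u
    using AE_spectral_scalar_measure[OF assms(3,4), of u] assms(1,2,5)
    by (intro integral_cong_AE) auto
  then show ?thesis by (simp add: spectral_form_def fun_eq_iff)
qed

end

section \<open>The functional calculus and the support of the spectral measure\<close>

lemma functional_calculus_inner:
  fixes E :: "real set \<Rightarrow> 'a::{real_inner, complete_space} \<Rightarrow> 'a"
  assumes "projection_valued_measure E"
    and "f \<in> borel_measurable borel" "\<And>t. 0 \<le> f t" "\<And>t. f t \<le> M"
  shows "functional_calculus E f u \<bullet> v = spectral_form E f u v"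
proof -
  \<comment> \<open>Boundedness in the second argument lets Riesz produce the vector that the
    \<open>THE\<close> in \<open>functional_calculus\<close> describes; it is unique because its
    inner products with all vectors are prescribed.\<close>
  have "bounded_linear (spectral_form E f u)"
    using linear_spectral_form[OF assms] abs_spectral_form_le[OF assms, of u]
    by (intro bounded_linear_intro[where K = "M * norm u"])
      (simp_all add: linear_add linear_scale mult_ac)
  then obtain w where w: "\<And>v. w \<bullet> v = spectral_form E f u v"
    using riesz_representation by metis
  then have "functional_calculus E f u = w"
    unfolding functional_calculus_def by (intro the_equality) (simp, metis vector_eq_rdot)
  then show ?thesis using w by simp
qed

text \<open>For \<open>u\<close> in the range of \<open>E N\<close>, with \<open>N\<close> the
  negative part of the support, the scalar measure lives where \<open>t < 0\<close>. Hence
  \<open>T u \<bullet> u\<close> is an integral of a negative function, and positivity of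
  \<open>T\<close> forces the measure, and so \<open>u\<close>, to vanish.\<close>

lemma spectral_measure_nonneg_support:
  assumes "is_spectral_measure T E" and pos: "\<And>u. 0 \<le> T u \<bullet> u"
  obtains R where "E {0..R} = id"
proof -
  have pvm: "projection_valued_measure E" and T: "\<And>u v. T u \<bullet> v = spectral_form E (\<lambda>t. t) u v"
    using assms(1) by (auto simp: is_spectral_measure_def)
  obtain R where R: "E {-R..R} = id" using assms(1) by (auto simp: is_spectral_measure_def)
  define N where "N = {-R..R} - {0..R}"
  have N: "N \<in> sets borel" by (simp add: N_def)
  have "E N x = 0" for x
  proof -
    define u where "u = E N x"
    \<comment> \<open>The form at \<open>(u, u)\<close> integrates against the scalar measures of
      \<open>u + u\<close> and \<open>u - u = 0\<close>; the latter is null, so only this one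
      contributes.\<close>
    let ?\<mu> = "spectral_scalar_measure E (u + u)"
    interpret finite_measure ?\<mu> by (rule finite_spectral_scalar_measure[OF pvm])
    have uu: "u + u = E N (x + x)"
      by (simp add: u_def linear_add[OF bounded_linear.linear[OF pvm_linear[OF pvm N]]])
    have ae: "AE t in ?\<mu>. t \<in> N"
    proof (rule AE_I)
      show "{t \<in> space ?\<mu>. t \<notin> N} \<subseteq> - N" by auto
      show "emeasure ?\<mu> (- N) = 0"
        using N by (simp add: emeasure_spectral_scalar_measure[OF pvm] uu pvm_Int[OF pvm]
            pvm_empty[OF pvm])
      show "- N \<in> sets ?\<mu>" using N by simp
    qed
    have "AE t in spectral_scalar_measure E 0. False"
      by (rule AE_I[where N = UNIV])
        (simp_all add: emeasure_spectral_scalar_measure[OF pvm])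
    then have "integral\<^sup>L (spectral_scalar_measure E 0) (\<lambda>t. t) = 0"
      by (intro integral_eq_zero_AE) auto
    then have "0 \<le> integral\<^sup>L ?\<mu> (\<lambda>t. t)"
      using pos[of u] by (simp add: T spectral_form_def)
    moreover have int: "integrable ?\<mu> (\<lambda>t. - t)"
      using ae by (intro integrable_const_bound[of _ "\<bar>R\<bar>"]) (auto simp: N_def)
    moreover have nn: "AE t in ?\<mu>. 0 \<le> - t" using ae by eventually_elim (auto simp: N_def)
    ultimately have "integral\<^sup>L ?\<mu> (\<lambda>t. - t) = 0"
      using integral_nonneg_AE[OF nn] by simp
    then have "AE t in ?\<mu>. - t = 0"
      using integral_nonneg_eq_0_iff_AE[OF int nn] by simp
    with ae have "AE t in ?\<mu>. False" by eventually_elim (auto simp: N_def)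
    then have "emeasure ?\<mu> UNIV = 0"
      using AE_iff_measurable[of UNIV ?\<mu> "\<lambda>_. False"] by simp
    then have "(u + u) \<bullet> (u + u) \<le> 0"
      by (simp add: emeasure_spectral_scalar_measure[OF pvm] pvm_UNIV[OF pvm] ennreal_eq_0_iff)
    then have "u + u = 0" by (metis inner_eq_zero_iff inner_ge_zero order_antisym)
    then show ?thesis by (simp add: u_def flip: scaleR_2)
  qed
  moreover have "{-R..R} = N \<union> ({-R..R} \<inter> {0..R})" by (auto simp: N_def)
  moreover have "N \<inter> ({-R..R} \<inter> {0..R}) = {}" by (auto simp: N_def)
  ultimately have "E {-R..R} x = E ({-R..R} \<inter> {0..R}) x" for x
    using pvm_Un[OF pvm N, of "{-R..R} \<inter> {0..R}" x] by (metis add_0 borel_closed closed_Int closed_atLeastAtMost)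
  then have "E {0..R} = id"
    using pvm_restrict[OF pvm _ R, of "{0..R}"] R by (simp add: fun_eq_iff)
  then show ?thesis by (rule that)
qed

section \<open>Powers of the operator and their spectral estimates\<close>

locale nonneg_spectral_measure =
  fixes E :: "real set \<Rightarrow> 'a::{real_inner, complete_space} \<Rightarrow> 'a" and R :: real
  assumes pvm: "projection_valued_measure E"
    and support: "E {0..R} = id"
begin

text \<open>Cutting off outside the support makes the power bounded on the whole line without changing
  its functional calculus.\<close>

definition truncated_powr :: "real \<Rightarrow> real \<Rightarrow> real" where
  "truncated_powr r t = indicator {0..R} t * t powr r"

lemma truncated_powr_measurable [measurable]: "truncated_powr r \<in> borel_measurable borel"
  unfolding truncated_powr_def[abs_def] by measurable

lemma truncated_powr_bounds:
  assumes "0 \<le> r"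
  shows "0 \<le> truncated_powr r t" "truncated_powr r t \<le> R powr r"
  using assms by (auto simp: truncated_powr_def indicator_def powr_mono2)

lemma operator_power_inner:
  assumes "0 \<le> r"
  shows "operator_power E r u \<bullet> v = spectral_form E (truncated_powr r) u v"
proof -
  have "spectral_form E (\<lambda>t. t powr r) = spectral_form E (truncated_powr r)"
    by (rule spectral_form_cong[OF pvm _ _ _ support]) (auto simp: truncated_powr_def)
  then have "operator_power E r u = functional_calculus E (truncated_powr r) u"
    by (simp add: operator_power_def functional_calculus_def)
  then show ?thesis
    using functional_calculus_inner[OF pvm truncated_powr_measurable truncated_powr_bounds[OF assms]]
    by simp
qed

text \<open>Pairing the vector with itself moves the projection into the integrand as a cutoff to
  \<open>{0..s}\<close>, where the power is at most \<open>s powr r\<close>.\<close>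

lemma norm_operator_power_le:
  assumes r: "0 \<le> r" and s: "0 \<le> s"
  shows "norm (operator_power E r (E {0..s} u)) \<le> s powr r * norm u"
proof -
  let ?f = "\<lambda>t. indicator {0..s} t * truncated_powr r t"
  define w where "w = operator_power E r (E {0..s} u)"
  have "w \<bullet> w = spectral_form E ?f u w"
    unfolding w_def operator_power_inner[OF r]
    by (rule spectral_form_projection[OF pvm truncated_powr_measurable truncated_powr_bounds[OF r]])
      simp
  also have "\<dots> \<le> s powr r * norm u * norm w"
  proof (rule order_trans[OF abs_ge_self abs_spectral_form_le[OF pvm]])
    show "0 \<le> ?f t" "?f t \<le> s powr r" for t
      using r by (auto simp: truncated_powr_def indicator_def powr_mono2)
  qed simp
  finally have "norm w * norm w \<le> (s powr r * norm u) * norm w"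
    by (simp add: power2_norm_eq_inner power2_eq_square[symmetric])
  then show ?thesis
    unfolding w_def[symmetric]
    by (cases "w = 0") (use s in simp_all)
qed

text \<open>Pairing \<open>operator_power E r u\<close> with the tail of \<open>u\<close> gives the
  integral of the power over \<open>t > s\<close>, which is at least \<open>s powr r\<close> times
  the squared norm of the tail. Cauchy-Schwarz then lets one factor of that norm cancel.\<close>

lemma norm_tail_le_operator_power:
  assumes r: "0 \<le> r" and s: "0 \<le> s"
  shows "s powr r * norm (E {s<..} u) \<le> norm (operator_power E r u)"
proof -
  define A where "A = {0..R} \<inter> {s<..}"
  have A: "A \<in> sets borel" by (simp add: A_def)
  let ?g = "truncated_powr r"
  \<comment> \<open>The excess of the power over \<open>s powr r\<close> on \<open>A\<close> is
    non-negative, so its form at \<open>(u, u)\<close> is too. Intersecting with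
    \<open>{0..R}\<close> matters here, since \<open>truncated_powr\<close> is zero beyond
    \<open>R\<close>.\<close>
  let ?h = "\<lambda>t. indicator A t * ?g t - s powr r * indicator A t"
  note g = truncated_powr_measurable truncated_powr_bounds[OF r]
  have h: "?h \<in> borel_measurable borel" "0 \<le> ?h t" "?h t \<le> R powr r" for t
    using A r s truncated_powr_bounds[OF r, of t]
    by (auto simp: A_def truncated_powr_def indicator_def powr_mono2 intro: order_trans[of _ "t powr r"])
  have "spectral_form E (\<lambda>t. indicator A t * ?g t) u u
      = spectral_form E (\<lambda>t. ?h t + s powr r * indicator A t) u u" by simp
  also have "\<dots> = spectral_form E ?h u u + spectral_form E (\<lambda>t. s powr r * indicator A t) u u"
    by (rule spectral_form_add[OF pvm h, of _ "s powr r"]) (use A in \<open>auto simp: indicator_def\<close>)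
  also have "\<dots> \<ge> s powr r * (E A u \<bullet> u)"
    using spectral_form_self_nonneg[OF pvm h, of u]
    by (simp add: spectral_form_mult[OF pvm] spectral_form_indicator[OF pvm A])
  finally have "s powr r * (norm (E A u))\<^sup>2 \<le> spectral_form E ?g (E A u) u"
    by (simp add: spectral_form_projection[OF pvm g A] pvm_inner_self[OF pvm A])
  also have "\<dots> = operator_power E r u \<bullet> E A u"
    by (simp add: operator_power_inner[OF r] spectral_form_commute[OF pvm g])
  also have "\<dots> \<le> norm (operator_power E r u) * norm (E A u)"
    by (rule norm_cauchy_schwarz)
  finally have "s powr r * norm (E A u) \<le> norm (operator_power E r u)"
    by (cases "E A u = 0") (simp_all add: power2_eq_square)
  moreover have "E {s<..} u = E A u"
    unfolding A_def by (rule pvm_restrict[OF pvm _ support]) simp_all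
  ultimately show ?thesis by simp
qed

lemma inner_tail_le:
  assumes tail: "\<And>t. 0 \<le> t \<Longrightarrow> norm (E {0..t} x) \<le> C * t powr a"
    and C: "0 \<le> C" and a: "0 \<le> a" and r: "a < r" and s: "0 < s"
  shows "x \<bullet> E {s<..} u
    \<le> C * 2 powr a / (1 - 2 powr (a - r)) * s powr (a - r) * norm (operator_power E r u)"
proof -
  define w where "w = norm (operator_power E r u)"
  define q where "q = 2 powr (a - r)"
  have q: "0 < q" "q < 1" using r by (auto simp: q_def powr_less_one)
  define K where "K = C * 2 powr a * s powr (a - r) * w"
  have K: "0 \<le> K" using C by (simp add: K_def w_def)
  have piece: "x \<bullet> E {2 ^ n * s<..2 ^ Suc n * s} u \<le> K * q ^ n" for n
  proof -
    define b where "b = 2 ^ n * s"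
    have b: "b > 0" using s by (simp add: b_def)
    let ?A = "{b<..2 * b}"
    have "x \<bullet> E ?A u = E ?A x \<bullet> E ?A u"
      using pvm_inner_commute[OF pvm, of ?A x "E ?A u"] pvm_Int[OF pvm, of ?A ?A u] by simp
    also have "\<dots> \<le> norm (E ?A x) * norm (E ?A u)" by (rule norm_cauchy_schwarz)
    \<comment> \<open>The upper endpoint \<open>2 * b\<close> controls \<open>x\<close> and the
      lower endpoint \<open>b\<close> controls \<open>u\<close>; this mismatch is the source of the
      factor \<open>2 powr a\<close>.\<close>
    also have "\<dots> \<le> (C * (2 * b) powr a) * (w / b powr r)"
    proof (rule mult_mono)
      have "norm (E ?A x) \<le> norm (E {0..2 * b} x)"
        using b by (intro pvm_norm_mono[OF pvm]) auto
      then show "norm (E ?A x) \<le> C * (2 * b) powr a" using tail[of "2 * b"] b by simp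
      have "norm (E ?A u) \<le> norm (E {b<..} u)" by (intro pvm_norm_mono[OF pvm]) auto
      also have "\<dots> \<le> w / b powr r"
        using norm_tail_le_operator_power[of r b u] a r b
        by (simp add: w_def pos_le_divide_eq mult.commute)
      finally show "norm (E ?A u) \<le> w / b powr r" .
    qed (use C b in simp_all)
    also have "\<dots> = C * 2 powr a * w * b powr (a - r)"
      using b by (simp add: powr_mult powr_diff)
    also have "b powr (a - r) = s powr (a - r) * q ^ n"
      using s by (simp add: b_def q_def powr_mult powr_powr mult.commute flip: powr_realpow)
    finally show ?thesis by (simp add: K_def b_def mult_ac)
  qed
  \<comment> \<open>After \<open>n\<close> dyadic pieces are split off, a tail remains. The support
    is bounded, so this tail vanishes once \<open>2 ^ n * s\<close> exceeds \<open>R\<close>, and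
    finitely many pieces suffice.\<close>
  have sum: "x \<bullet> E {s<..} u \<le> (\<Sum>k<n. K * q ^ k) + x \<bullet> E {2 ^ n * s<..} u" for n
  proof (induction n)
    case (Suc n)
    define A B where "A = {2 ^ n * s<..2 ^ Suc n * s}" and "B = {2 ^ Suc n * s<..}"
    have "E (A \<union> B) u = E A u + E B u" by (rule pvm_Un[OF pvm]) (auto simp: A_def B_def)
    moreover have "A \<union> B = {2 ^ n * s<..}"
      using s unfolding A_def B_def by (intro ivl_disj_un_one(5)) simp
    ultimately have "x \<bullet> E {2 ^ n * s<..} u = x \<bullet> E A u + x \<bullet> E B u"
      by (simp only: inner_add_right)
    then show ?case using Suc piece[of n] by (simp only: sum.lessThan_Suc A_def B_def)
  qed simp
  obtain n where "R / s < 2 ^ n" using real_arch_pow[of 2] by auto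
  then have "{0..R} \<inter> {2 ^ n * s<..} = {}" using s by (auto simp: field_simps)
  then have "E {2 ^ n * s<..} u = 0"
    using pvm_restrict[OF pvm _ support, of "{2 ^ n * s<..}" u] by (simp add: pvm_empty[OF pvm])
  then have "x \<bullet> E {s<..} u \<le> K * (\<Sum>k<n. q ^ k)"
    using sum[of n] by (simp add: sum_distrib_left)
  also have "\<dots> \<le> K * (1 / (1 - q))"
    using K q sum_le_suminf[of "\<lambda>k. q ^ k" "{..<n}"] summable_geometric[of q] suminf_geometric[of q]
    by (intro mult_left_mono) simp_all
  finally show ?thesis by (simp add: K_def q_def w_def mult_ac)
qed

section \<open>Spectral tails and the interpolation inequality\<close>

theorem spectral_tail_iff:
  assumes \<nu>: "0 < \<nu>" and \<rho>: "\<nu> < \<rho>"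
  shows "spectral_tail E \<nu> x \<longleftrightarrow>
    (\<exists>\<beta>\<ge>0. \<forall>u. 2 * (x \<bullet> u)
        \<le> \<beta> * norm (operator_power E (\<rho> / 2) u) powr (\<nu> / \<rho>) * norm u powr (1 - \<nu> / \<rho>))"
    (is "_ \<longleftrightarrow> ?ineq")
proof
  assume "spectral_tail E \<nu> x"
  then obtain C where C: "C > 0"
    and "\<And>t. 0 \<le> t \<Longrightarrow> (norm (E {0..t} x))\<^sup>2 \<le> C\<^sup>2 * t powr \<nu>"
    by (auto simp: spectral_tail_def)
  moreover have "C\<^sup>2 * t powr \<nu> = (C * t powr (\<nu> / 2))\<^sup>2" for t
    by (simp add: power_mult_distrib power2_eq_square[of "_ powr _"] flip: powr_add)
  ultimately have tail: "norm (E {0..t} x) \<le> C * t powr (\<nu> / 2)" if "0 \<le> t" for t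
    using that by (metis power2_le_imp_le less_imp_le mult_nonneg_nonneg powr_ge_zero)
  \<comment> \<open>The constant of \<open>inner_tail_le\<close> for \<open>a = \<nu> / 2\<close>
    and \<open>r = \<rho> / 2\<close>.\<close>
  define K where "K = C * 2 powr (\<nu> / 2) / (1 - 2 powr (\<nu> / 2 - \<rho> / 2))"
  have K: "0 \<le> K"
    unfolding K_def using C \<rho> powr_less_one[of 2 "\<nu> / 2 - \<rho> / 2"] by simp
  have split: "x \<bullet> u \<le> C * t powr (\<nu> / 2) * norm u
      + K * t powr (\<nu> / 2 - \<rho> / 2) * norm (operator_power E (\<rho> / 2) u)" if t: "t > 0" for t u
  proof -
    have "E {t<..} u = E ({0..R} \<inter> {t<..}) u" "E {0..t} u = E ({0..R} \<inter> {0..t}) u"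
      by (rule pvm_restrict[OF pvm _ support]; simp)+
    moreover have "({0..R} \<inter> {0..t}) \<union> ({0..R} \<inter> {t<..}) = {0..R}"
      and "({0..R} \<inter> {0..t}) \<inter> ({0..R} \<inter> {t<..}) = {}" using t by auto
    then have "E {0..R} u = E ({0..R} \<inter> {0..t}) u + E ({0..R} \<inter> {t<..}) u"
      using pvm_Un[OF pvm, of "{0..R} \<inter> {0..t}" "{0..R} \<inter> {t<..}" u]
      by (metis sets.Int atLeastAtMost_borel greaterThan_borel)
    ultimately have "u = E {0..t} u + E {t<..} u" by (simp only: support id_apply)
    then have "x \<bullet> u = E {0..t} x \<bullet> u + x \<bullet> E {t<..} u"
      using pvm_inner_commute[OF pvm, of "{0..t}" x u] by (metis inner_add_right atLeastAtMost_borel)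
    also have "E {0..t} x \<bullet> u \<le> norm (E {0..t} x) * norm u" by (rule norm_cauchy_schwarz)
    also have "\<dots> \<le> C * t powr (\<nu> / 2) * norm u"
      using tail[of t] t by (intro mult_right_mono) simp_all
    also have "x \<bullet> E {t<..} u \<le> K * t powr (\<nu> / 2 - \<rho> / 2) * norm (operator_power E (\<rho> / 2) u)"
      unfolding K_def using \<nu> \<rho> t C by (intro inner_tail_le tail) simp_all
    finally show ?thesis by simp
  qed
  have "2 * (x \<bullet> u) \<le> 2 * (C + K)
      * norm (operator_power E (\<rho> / 2) u) powr (\<nu> / \<rho>) * norm u powr (1 - \<nu> / \<rho>)" for u
  proof -
    define w where "w = norm (operator_power E (\<rho> / 2) u)"
    consider "u = 0" | "u \<noteq> 0" "w = 0" | "u \<noteq> 0" "w > 0" by (force simp: w_def)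
    then show ?thesis
    proof cases
      case 1
      then show ?thesis by simp
    next
      case 2
      \<comment> \<open>The balancing \<open>t\<close> would be \<open>0\<close>, which
        \<open>split\<close> excludes, so \<open>t\<close> tends to \<open>0\<close> instead. The
        high part is zero and the low part vanishes in the limit; the target is also
        \<open>0\<close>, because \<open>0 powr (\<nu> / \<rho>) = 0\<close>.\<close>
      have "((\<lambda>t. C * t powr (\<nu> / 2) * norm u) \<longlongrightarrow> C * 0 * norm u) (at_right 0)"
        using \<nu> by (intro tendsto_intros) (real_asymp)
      moreover have "\<forall>\<^sub>F t in at_right 0. x \<bullet> u \<le> C * t powr (\<nu> / 2) * norm u"
        using split[of _ u] 2 unfolding w_def eventually_at_right_field
        by (auto intro!: exI[of _ 1])
      ultimately have "x \<bullet> u \<le> C * 0 * norm u"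
        by (rule tendsto_lowerbound) simp
      then show ?thesis using 2 by (simp add: w_def)
    next
      case 3
      define t where "t = (w / norm u) powr (2 / \<rho>)"
      have t: "t > 0" using 3 by (simp add: t_def)
      \<comment> \<open>For the balancing \<open>t\<close>, both
        \<open>t powr (\<nu> / 2) * norm u\<close> and
        \<open>t powr (\<nu> / 2 - \<rho> / 2) * w\<close> equal \<open>P\<close>, whence the
        constant \<open>C + K\<close>.\<close>
      define P where "P = w powr (\<nu> / \<rho>) * norm u powr (1 - \<nu> / \<rho>)"
      have "t powr (\<nu> / 2) = (w / norm u) powr (\<nu> / \<rho>)"
        by (simp add: t_def powr_powr)
      then have "t powr (\<nu> / 2) * norm u = P"
        using 3 by (simp add: P_def powr_divide powr_diff)
      moreover have "2 / \<rho> * (\<nu> / 2 - \<rho> / 2) = \<nu> / \<rho> - 1"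
        using \<nu> \<rho> by (simp add: field_simps)
      then have "t powr (\<nu> / 2 - \<rho> / 2) = (w / norm u) powr (\<nu> / \<rho> - 1)"
        by (simp only: t_def powr_powr)
      then have "t powr (\<nu> / 2 - \<rho> / 2) * w = P"
        using 3 by (simp add: P_def powr_divide powr_diff)
      ultimately have "x \<bullet> u \<le> C * P + K * P"
        using split[OF t, of u] by (simp only: w_def mult.assoc)
      then have "2 * (x \<bullet> u) \<le> 2 * (C + K) * P" by (simp add: distrib_right)
      then show ?thesis by (simp only: w_def P_def mult.assoc)
    qed
  qed
  then show ?ineq
    using C K by (intro exI[of _ "2 * (C + K)"]) auto
next
  assume ?ineq
  then obtain \<beta> where \<beta>: "\<beta> \<ge> 0" and ineq: "\<And>u. 2 * (x \<bullet> u)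
      \<le> \<beta> * norm (operator_power E (\<rho> / 2) u) powr (\<nu> / \<rho>) * norm u powr (1 - \<nu> / \<rho>)"
    by auto
  have "(norm (E {0..t} x))\<^sup>2 \<le> (\<beta> / 2 + 1)\<^sup>2 * t powr \<nu>" if t: "0 \<le> t" for t
  proof -
    define u where "u = E {0..t} x"
    have u: "E {0..t} u = u" using pvm_Int[OF pvm, of "{0..t}" "{0..t}" x] by (simp add: u_def)
    have "2 * (norm u)\<^sup>2 = 2 * (x \<bullet> u)"
      using pvm_inner_self[OF pvm, of "{0..t}" x] by (simp add: u_def inner_commute)
    also have "\<dots> \<le> \<beta> * norm (operator_power E (\<rho> / 2) u) powr (\<nu> / \<rho>) * norm u powr (1 - \<nu> / \<rho>)"
      by (rule ineq)
    also have "\<dots> \<le> \<beta> * (t powr (\<rho> / 2) * norm u) powr (\<nu> / \<rho>) * norm u powr (1 - \<nu> / \<rho>)"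
      using norm_operator_power_le[of "\<rho> / 2" t u] \<nu> \<rho> t \<beta>
      by (intro mult_right_mono mult_left_mono powr_mono2) (simp_all add: u)
    \<comment> \<open>The exponents \<open>\<nu> / \<rho>\<close> and
      \<open>1 - \<nu> / \<rho>\<close> of \<open>norm u\<close> add up to \<open>1\<close>, so one
      factor \<open>norm u\<close> can be cancelled afterwards.\<close>
    also have "\<dots> = \<beta> * t powr (\<nu> / 2) * norm u"
      using t \<nu> \<rho> by (cases "u = 0") (simp_all add: powr_mult powr_powr powr_diff)
    finally have "norm u \<le> \<beta> / 2 * t powr (\<nu> / 2)"
      using \<beta> by (cases "u = 0") (simp_all add: power2_eq_square)
    \<comment> \<open>Adding \<open>1\<close> keeps the tail constant strictly positive even if
      \<open>\<beta> = 0\<close>.\<close>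
    also have "\<dots> \<le> (\<beta> / 2 + 1) * t powr (\<nu> / 2)"
      by (intro mult_right_mono) simp_all
    finally have "(norm u)\<^sup>2 \<le> ((\<beta> / 2 + 1) * t powr (\<nu> / 2))\<^sup>2"
      by (intro power_mono) simp_all
    then show ?thesis
      by (simp add: u_def power_mult_distrib power2_eq_square[of "_ powr _"] flip: powr_add)
  qed
  then show "spectral_tail E \<nu> x"
    using \<beta> unfolding spectral_tail_def by (intro exI[of _ "\<beta> / 2 + 1"]) auto
qed

end

theorem proposition11:
  fixes L :: "'u::{real_inner, complete_space} \<Rightarrow> 'v::{real_inner, complete_space}"
    and y :: 'v
    and E :: "real set \<Rightarrow> 'u \<Rightarrow> 'u"
    and \<nu> \<rho> :: real
  assumes "bounded_linear L"
    and "y \<in> range L"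
    and "is_spectral_measure (adjoint L \<circ> L) E"
    and "0 < \<nu>" and "\<nu> < 2" and "\<rho> > \<nu>"
  defines "udag \<equiv> min_norm_solution L y"
  shows "spectral_tail E \<nu> udag \<longleftrightarrow>
    (\<exists>\<beta>\<ge>0. \<forall>u. 2 * (udag \<bullet> u)
        \<le> \<beta> * norm (operator_power E (\<rho> / 2) u) powr (\<nu> / \<rho>) * norm u powr (1 - \<nu> / \<rho>))"
proof -
  \<comment> \<open>This inner product is the squared norm of \<open>L u\<close>; its non-negativity
    confines the support of \<open>E\<close> to some \<open>{0..R}\<close>.\<close>
  have "0 \<le> (adjoint L \<circ> L) u \<bullet> u" for u
    using adjoint_inner[OF assms(1), of u "L u"] by (metis comp_apply inner_commute inner_ge_zero)
  then obtain R where "E {0..R} = id"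
    using spectral_measure_nonneg_support[OF assms(3)] by blast
  then interpret nonneg_spectral_measure E R
    using assms(3) by unfold_locales (auto simp: is_spectral_measure_def)
  show ?thesis by (rule spectral_tail_iff[OF assms(4,6)])
qed

end
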